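(* Let $m\geq 2$ and $0\leq k\leq m$ be integers and let $p$ be a prime. Then $s_p(\Delta^m_{(k)})=1$ if and only if one of the following holds: (i) $k\not\equiv p-1\pmod p$ and \[ m-\left\lfloor\frac{m}{p+1}\right\rfloor-1\leq k\leq m-1; \] (ii) $k\equiv p-1\pmod p$ and \[ p\cdot\left\lfloor\frac{m-1}{p+1}\right\rfloor+p-1\leq k\leq m-1. \]
   Context: For a prime $p$ and an integer $n\ge 0$, the universal simplicial complex $X(\mathbb{F}_p^n)$ is the abstract simplicial complex whose vertices are the nonzero vectors of $\mathbb{F}_p^n$ and whose simplices are the sets of vectors that are linearly independent over $\mathbb{F}_p$. A simplicial map is nondegenerate if it is injective on the vertex set of every simplex (equivalently, it maps every $j$-simplex onto a $j$-simplex). For a finite simplicial complex $\mathcal{K}$ with $N$ vertices, the mod $p$ Buchstaber invariant of $\mathcal{K}$ is the integer $s_p(\mathcal{K})=N-r$, where $r$ is the least integer such that there is a nondegenerate simplicial map $\mathcal{K}\to X(\mathbb{F}_p^r)$. $\Delta^m$ is the $m$-simplex on the vertex set $\{1,\ldots,m+1\}$, and $\Delta^m_{(k)}$ is its $k$-skeleton, i.e. the simplices are the subsets of $\{1,\ldots,m+1\}$ with at most $k+1$ elements. *)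

theory Defs
  imports "HOL-Number_Theory.Residues" "Jordan_Normal_Form.Missing_VectorSpace"
begin

text \<open>
  An abstract simplicial complex is given by its set of simplices, a downward closed set of
  finite sets. The empty simplex belongs to every nonempty complex; the vertices are the points
  \<open>v\<close> for which \<open>{v}\<close> is a simplex.
\<close>

definition abstract_complex :: "'a set set \<Rightarrow> bool" where
  "abstract_complex K \<longleftrightarrow> (\<forall>S\<in>K. finite S \<and> (\<forall>T\<subseteq>S. T \<in> K))"

definition vertices :: "'a set set \<Rightarrow> 'a set" where
  "vertices K = {v. {v} \<in> K}"

text \<open>
  Values of \<open>f\<close> outside \<open>vertices K\<close> are irrelevant. Vertices go to vertices, since an image of a
  singleton is a singleton.
\<close>

definition simplicial_map :: "('a \<Rightarrow> 'b) \<Rightarrow> 'a set set \<Rightarrow> 'b set set \<Rightarrow> bool" where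
  "simplicial_map f K L \<longleftrightarrow> (\<forall>S\<in>K. f ` S \<in> L)"

definition nondegenerate :: "('a \<Rightarrow> 'b) \<Rightarrow> 'a set set \<Rightarrow> bool" where
  "nondegenerate f K \<longleftrightarrow> (\<forall>S\<in>K. inj_on f S)"

definition simplex :: "nat \<Rightarrow> nat set set" where
  "simplex m = Pow {1..m + 1}"

definition skeleton :: "nat \<Rightarrow> 'a set set \<Rightarrow> 'a set set" where
  "skeleton k K = {S \<in> K. card S \<le> k + 1}"

text \<open>
  \<open>\<F>\<^sub>p\<^sup>n\<close> is the module over \<open>residue_ring p\<close> of functions on \<open>{..<n}\<close>, extended by \<open>undefined\<close>.
\<close>

abbreviation Fp :: "nat \<Rightarrow> int ring" where
  "Fp p \<equiv> residue_ring (int p)"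

definition Fp_space :: "nat \<Rightarrow> nat \<Rightarrow> (int, nat \<Rightarrow> int) module" where
  "Fp_space p n = ring.func_space (Fp p) {..<n}"

definition universal_complex :: "nat \<Rightarrow> nat \<Rightarrow> (nat \<Rightarrow> int) set set" where
  "universal_complex p n =
     {S. S \<subseteq> carrier (Fp_space p n) - {\<zero>\<^bsub>Fp_space p n\<^esub>} \<and>
         \<not> module.lin_dep (Fp p) (Fp_space p n) S}"

text \<open>
  For finite \<open>K\<close> and prime \<open>p\<close> the set of admissible \<open>r\<close> is nonempty: with \<open>r\<close> the number of
  vertices, send the vertices to distinct standard basis vectors.
\<close>

definition buchstaber :: "nat \<Rightarrow> 'a set set \<Rightarrow> int" where
  "buchstaber p K =
     int (card (vertices K)) -
     int (LEAST r. \<exists>f. simplicial_map f K (universal_complex p r) \<and> nondegenerate f K)"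

lemma vectorspace_Fp_space:
  assumes "prime p"
  shows "vectorspace (Fp p) (Fp_space p n)"
proof -
  interpret residues_prime p "Fp p"
    by unfold_locales (use assms in auto)
  have "module (Fp p) (Fp_space p n)"
    unfolding Fp_space_def by (rule func_space_is_module)
  then show ?thesis
    unfolding vectorspace_def using is_field by simp
qed

lemma abstract_complex_universal_complex:
  assumes "prime p"
  shows "abstract_complex (universal_complex p n)"
proof -
  interpret V: vectorspace "Fp p" "Fp_space p n"
    using assms by (rule vectorspace_Fp_space)
  interpret residues_prime p "Fp p"
    by unfold_locales (use assms in auto)
  have "finite (carrier (Fp p))"
    by (simp add: residue_ring_def)
  then have "finite (carrier (Fp_space p n))"
    unfolding Fp_space_def V.func_space_def by (auto intro: finite_PiE)
  then show ?thesis
    unfolding abstract_complex_def universal_complex_def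
    by (auto intro: finite_subset dest: V.supset_ld_is_ld)
qed

lemma vertices_universal_complex:
  assumes "prime p"
  shows "vertices (universal_complex p n) = carrier (Fp_space p n) - {\<zero>\<^bsub>Fp_space p n\<^esub>}"
proof -
  interpret V: vectorspace "Fp p" "Fp_space p n"
    using assms by (rule vectorspace_Fp_space)
  have "\<not> V.lin_dep {v}"
    if v: "v \<in> carrier (Fp_space p n)" "v \<noteq> \<zero>\<^bsub>Fp_space p n\<^esub>" for v
  proof
    assume "V.lin_dep {v}"
    then obtain A a w where A: "A \<subseteq> {v}" "a \<in> A \<rightarrow> carrier (Fp p)"
        "V.lincomb a A = \<zero>\<^bsub>Fp_space p n\<^esub>" "w \<in> A" "a w \<noteq> \<zero>\<^bsub>Fp p\<^esub>"
      unfolding V.lin_dep_def by auto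
    from A have [simp]: "A = {v}" "w = v" by auto
    have c: "a v \<in> carrier (Fp p)" using A by auto
    have "a v \<odot>\<^bsub>Fp_space p n\<^esub> v = \<zero>\<^bsub>Fp_space p n\<^esub>"
      using A(3) v c by (simp add: V.lincomb_def)
    moreover have "a v \<in> Units (Fp p)"
      using c A(5) V.field_Units by simp
    ultimately have "v = \<zero>\<^bsub>Fp_space p n\<^esub>"
      by (metis V.Units_inv_closed V.Units_l_inv V.smult_assoc1 V.smult_one V.smult_r_null c v(1))
    with v show False by simp
  qed
  then show ?thesis
    unfolding vertices_def universal_complex_def by auto
qed

lemma abstract_complex_skeleton_simplex: "abstract_complex (skeleton k (simplex m))"
  unfolding abstract_complex_def skeleton_def simplex_def
  by (auto intro: finite_subset order_trans[OF card_mono])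

lemma vertices_skeleton_simplex: "vertices (skeleton k (simplex m)) = {1..m + 1}"
  unfolding vertices_def skeleton_def simplex_def by auto

end

theory Submission
  imports Defs
begin

text \<open>
The argument is coding theory. A map from the vertices of \<open>\<Delta>\<^sup>m\<close> to \<open>\<F>\<^sub>p\<^sup>r\<close> is a list of \<open>m + 1\<close> vectors,
and the linear relations between these vectors form a linear code of length \<open>m + 1\<close> and dimension
at least \<open>m + 1 - r\<close>. The map is simplicial and nondegenerate on the \<open>k\<close>-skeleton iff any \<open>k + 1\<close> of the
vectors are independent, that is, iff every nonzero word of the code has weight at least \<open>k + 2\<close>
(\<open>weight_relation_gt_if_nondegenerate_map\<close>, \<open>nondegenerate_map_if_weight_relation_gt\<close>). Thus the
invariant is the largest dimension of a code of length \<open>m + 1\<close> and minimum weight at least \<open>k + 2\<close>, and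
the question is when dimension one is possible but dimension two is not.

Dimension one is possible iff \<open>k < m\<close>, by the repetition code. For dimension two, averaging the
weight over all words shows that the minimum weight is at most \<open>(m + 1) * p / (p + 1)\<close>
(\<open>plotkin_bound\<close>), and evaluating linear forms at evenly repeated points of the projective line
over \<open>\<F>\<^sub>p\<close> attains the integer part of this bound (\<open>two_dim_code_weight\<close>). Consequently the invariant is \<open>1\<close> iff
\<open>m - m div (p + 1) - 1 \<le> k \<le> m - 1\<close>, whatever the residue of \<open>k\<close> modulo \<open>p\<close>
(\<open>buchstaber_skeleton_simplex_eq_1_iff\<close>). For \<open>k\<close> congruent to \<open>p - 1\<close> the lower bound may be
rounded up to the next number in that residue class, which gives the second form of the criterion
(\<open>last_residue_class_threshold\<close>).
\<close>

section \<open>Nondegenerate maps and minimum weight\<close>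

text \<open>
The rows \<open>H i\<close> are vectors indexed by \<open>I\<close>; a relation is a tuple of coefficients of a linear
dependency between them. Canonical representatives modulo \<open>p\<close> are used, extended by \<open>undefined\<close>
outside \<open>I\<close>, so that the set of relations is finite and can be counted. In coding theory this is
the linear code with parity check matrix \<open>H\<close> (transposed), and \<open>weight\<close> below is the Hamming weight.
\<close>

definition relations :: "nat \<Rightarrow> nat \<Rightarrow> 'a set \<Rightarrow> ('a \<Rightarrow> nat \<Rightarrow> int) \<Rightarrow> ('a \<Rightarrow> int) set" where
  "relations p r I H =
     {c \<in> I \<rightarrow>\<^sub>E {0..<int p}. \<forall>j<r. int p dvd (\<Sum>i\<in>I. c i * H i j)}"

definition weight :: "'a set \<Rightarrow> ('a \<Rightarrow> int) \<Rightarrow> nat" where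
  "weight I c = card {i \<in> I. c i \<noteq> 0}"

lemma carrier_Fp: "carrier (Fp p) = {0..<int p}"
  by (auto simp: residue_ring_def)

lemma zero_Fp: "\<zero>\<^bsub>Fp p\<^esub> = 0"
  by (simp add: residue_ring_def)

lemma Fp_space_simps:
  assumes "prime p"
  shows "carrier (Fp_space p r) = {..<r} \<rightarrow>\<^sub>E {0..<int p}"
    and "\<zero>\<^bsub>Fp_space p r\<^esub> = (\<lambda>j\<in>{..<r}. 0)"
    and "v \<oplus>\<^bsub>Fp_space p r\<^esub> w = (\<lambda>j\<in>{..<r}. (v j + w j) mod int p)"
    and "x \<odot>\<^bsub>Fp_space p r\<^esub> v = (\<lambda>j\<in>{..<r}. (x * v j) mod int p)"
proof -
  interpret residues_prime p "Fp p"
    by unfold_locales (use assms in auto)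
  show "carrier (Fp_space p r) = {..<r} \<rightarrow>\<^sub>E {0..<int p}"
    "\<zero>\<^bsub>Fp_space p r\<^esub> = (\<lambda>j\<in>{..<r}. 0)"
    "v \<oplus>\<^bsub>Fp_space p r\<^esub> w = (\<lambda>j\<in>{..<r}. (v j + w j) mod int p)"
    "x \<odot>\<^bsub>Fp_space p r\<^esub> v = (\<lambda>j\<in>{..<r}. (x * v j) mod int p)"
    by (simp_all add: Fp_space_def func_space_def carrier_Fp zero_Fp res_add_eq res_mult_eq)
qed

text \<open>
Linear combinations in the module are computed coordinatewise by integer sums. This lets
linear independence be rephrased as a statement about divisibility of integers by \<open>p\<close>.
\<close>

lemma lincomb_Fp_space:
  assumes "prime p" "finite A" "A \<subseteq> carrier (Fp_space p r)" "a \<in> A \<rightarrow> carrier (Fp p)"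
  shows "module.lincomb (Fp_space p r) a A = (\<lambda>j\<in>{..<r}. (\<Sum>v\<in>A. a v * v j) mod int p)"
proof -
  interpret V: vectorspace "Fp p" "Fp_space p r"
    using assms(1) by (rule vectorspace_Fp_space)
  show ?thesis
    using assms(2-4) unfolding V.lincomb_def
  proof (induction A rule: finite_induct)
    case empty
    then show ?case by (simp add: Fp_space_simps[OF assms(1)])
  next
    case (insert v A)
    have c: "a v \<odot>\<^bsub>Fp_space p r\<^esub> v \<in> carrier (Fp_space p r)"
      "(\<lambda>v. a v \<odot>\<^bsub>Fp_space p r\<^esub> v) \<in> A \<rightarrow> carrier (Fp_space p r)"
      using insert.prems by (auto intro!: V.smult_closed)
    have IH: "(\<Oplus>\<^bsub>Fp_space p r\<^esub>v\<in>A. a v \<odot>\<^bsub>Fp_space p r\<^esub> v) =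
        (\<lambda>j\<in>{..<r}. (\<Sum>v\<in>A. a v * v j) mod int p)"
      using insert.prems by (intro insert.IH) auto
    have "(\<Oplus>\<^bsub>Fp_space p r\<^esub>v\<in>insert v A. a v \<odot>\<^bsub>Fp_space p r\<^esub> v) =
        a v \<odot>\<^bsub>Fp_space p r\<^esub> v \<oplus>\<^bsub>Fp_space p r\<^esub> (\<Oplus>\<^bsub>Fp_space p r\<^esub>v\<in>A. a v \<odot>\<^bsub>Fp_space p r\<^esub> v)"
      using insert.hyps c by (simp add: V.finsum_insert)
    also have "\<dots> = (\<lambda>j\<in>{..<r}. (\<Sum>v\<in>insert v A. a v * v j) mod int p)"
      unfolding IH unfolding Fp_space_simps(3,4)[OF assms(1)]
      using insert.hyps by (auto simp: mod_simps intro!: ext)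
    finally show ?case .
  qed
qed

lemma lincomb_eq_zero_iff:
  assumes "prime p" "finite A" "A \<subseteq> carrier (Fp_space p r)" "a \<in> A \<rightarrow> carrier (Fp p)"
  shows "module.lincomb (Fp_space p r) a A = \<zero>\<^bsub>Fp_space p r\<^esub> \<longleftrightarrow>
    (\<forall>j<r. int p dvd (\<Sum>v\<in>A. a v * v j))"
  unfolding lincomb_Fp_space[OF assms] Fp_space_simps(2)[OF assms(1)]
  by (auto simp: fun_eq_iff dvd_eq_mod_eq_0 restrict_def split: if_splits)

text \<open>
A nonzero relation of weight at most \<open>d\<close> is a nontrivial dependency between the images of its
support, which is a simplex. Injectivity on the support matters: it is what allows the coefficient
\<open>c i\<close> to be read as a coefficient of the vector \<open>f i\<close>.
\<close>

lemma weight_relation_gt_if_nondegenerate_map: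
  assumes p: "prime p" and I: "finite I"
    and f: "simplicial_map f {S. S \<subseteq> I \<and> card S \<le> d} (universal_complex p r)"
           "nondegenerate f {S. S \<subseteq> I \<and> card S \<le> d}"
    and c: "c \<in> relations p r I f" and i: "i \<in> I" "c i \<noteq> 0"
  shows "d < weight I c"
proof (rule ccontr)
  assume w: "\<not> d < weight I c"
  define S where "S = {i \<in> I. c i \<noteq> 0}"
  interpret V: vectorspace "Fp p" "Fp_space p r"
    using p by (rule vectorspace_Fp_space)
  have S: "S \<subseteq> I" "card S \<le> d" "finite S" "i \<in> S"
    using w i I by (auto simp: S_def weight_def)
  have inj: "inj_on f S"
    using f(2) S by (auto simp: nondegenerate_def)
  have ind: "f ` S \<subseteq> carrier (Fp_space p r)" "\<not> V.lin_dep (f ` S)"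
    using f(1) S by (auto simp: simplicial_map_def universal_complex_def)
  define a where "a v = c (inv_into S f v)" for v
  have a: "a (f x) = c x" if "x \<in> S" for x
    using that inj by (simp add: a_def)
  have ac: "a \<in> f ` S \<rightarrow> carrier (Fp p)"
    using c S(1) by (auto simp: a relations_def carrier_Fp)
  have "(\<Sum>v\<in>f ` S. a v * v j) = (\<Sum>x\<in>I. c x * f x j)" for j
  proof -
    have "(\<Sum>v\<in>f ` S. a v * v j) = (\<Sum>x\<in>S. c x * f x j)"
      using inj by (simp add: sum.reindex a)
    also have "\<dots> = (\<Sum>x\<in>I. c x * f x j)"
      by (rule sum.mono_neutral_left) (auto simp: S_def I)
    finally show ?thesis .
  qed
  then have "V.lincomb a (f ` S) = \<zero>\<^bsub>Fp_space p r\<^esub>"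
    using c S ind ac by (subst lincomb_eq_zero_iff[OF p]) (auto simp: relations_def)
  then have "a \<in> f ` S \<rightarrow> {0}"
    using V.not_lindepD[OF ind(2) _ subset_refl ac] S by (simp add: zero_Fp)
  then show False
    using a[OF S(4)] S(4) i by (auto simp: Pi_iff)
qed

text \<open>
The converse: a dependency between at most \<open>d\<close> of the vectors, extended by zero, is a relation of
weight at most \<open>d\<close>. Two equal vectors give a relation of weight two, so large minimum weight also
forces injectivity on simplices.
\<close>

lemma nondegenerate_map_if_weight_relation_gt:
  assumes p: "prime p" and I: "finite I"
    and H: "\<And>c i. c \<in> relations p r I H \<Longrightarrow> i \<in> I \<Longrightarrow> c i \<noteq> 0 \<Longrightarrow> d < weight I c"
  shows "\<exists>f. simplicial_map f {S. S \<subseteq> I \<and> card S \<le> d} (universal_complex p r) \<and>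
    nondegenerate f {S. S \<subseteq> I \<and> card S \<le> d}"
proof -
  interpret V: vectorspace "Fp p" "Fp_space p r"
    using p by (rule vectorspace_Fp_space)
  define f where "f i = (\<lambda>j\<in>{..<r}. H i j mod int p)" for i
  have p1: "1 < int p" using p prime_gt_1_nat by auto
  have fc: "f i \<in> carrier (Fp_space p r)" for i
    using p1 by (auto simp: f_def Fp_space_simps[OF p])
  have vanish: "c i mod int p = 0"
    if S: "S \<subseteq> I" "card S \<le> d" and i: "i \<in> S"
      and c: "\<And>j. j < r \<Longrightarrow> int p dvd (\<Sum>x\<in>S. c x * f x j)" for S c i
  proof (rule ccontr)
    assume nz: "c i mod int p \<noteq> 0"
    define e where "e = (\<lambda>x\<in>I. if x \<in> S then c x mod int p else 0)"
    have "int p dvd (\<Sum>x\<in>I. e x * H x j)" if "j < r" for j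
    proof -
      have "(\<Sum>x\<in>I. e x * H x j) = (\<Sum>x\<in>S. (c x mod int p) * H x j)"
        using S I by (intro sum.mono_neutral_cong_right) (auto simp: e_def)
      also have "[\<dots> = (\<Sum>x\<in>S. c x * f x j)] (mod int p)"
        using that by (intro cong_sum) (auto simp: f_def cong_def mod_simps)
      finally show ?thesis
        using c[OF that] by (simp add: cong_dvd_iff)
    qed
    then have "e \<in> relations p r I H"
      using p1 by (auto simp: relations_def e_def)
    moreover have "i \<in> I" "e i \<noteq> 0"
      using S i nz by (auto simp: e_def)
    ultimately have "d < weight I e"
      by (rule H)
    also have "weight I e \<le> card S"
      unfolding weight_def using S I
      by (intro card_mono) (auto simp: e_def intro: finite_subset split: if_splits)
    finally show False using S by simp
  qed
  \<comment> \<open>If \<open>f x = f y\<close>, the coefficient vector supported on \<open>x\<close> and \<open>y\<close> with values \<open>1\<close> and \<open>-1\<close> is a relation.\<close>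
  have inj: "inj_on f S" if S: "S \<subseteq> I" "card S \<le> d" for S
  proof (rule inj_onI, rule ccontr)
    fix x y assume xy: "x \<in> S" "y \<in> S" "f x = f y" "x \<noteq> y"
    have "finite S" using S I finite_subset by auto
    then have "(\<Sum>z\<in>S. ((if z = x then 1 else 0) - (if z = y then 1 else 0)) * f z j) = 0" for j
      using xy by (simp add: left_diff_distrib sum_subtractf if_distrib [of "\<lambda>t. t * _"]
          cong: if_cong)
    then have "((if x = x then 1 else 0) - (if x = y then 1 else 0)) mod int p = 0"
      by (intro vanish[OF S xy(1)]) simp
    then show False using xy p1 by simp
  qed
  have indep: "\<not> V.lin_dep (f ` S)" if S: "S \<subseteq> I" "card S \<le> d" for S
  proof (rule V.finite_lin_indpt2)
    show fin: "finite (f ` S)" using S I finite_subset by auto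
    show car: "f ` S \<subseteq> carrier (Fp_space p r)" using fc by auto
    fix a assume a: "a \<in> f ` S \<rightarrow> carrier (Fp p)" "V.lincomb a (f ` S) = \<zero>\<^bsub>Fp_space p r\<^esub>"
    have "int p dvd (\<Sum>x\<in>S. a (f x) * f x j)" if "j < r" for j
      using a(2) that unfolding lincomb_eq_zero_iff[OF p fin car a(1)]
      by (simp add: sum.reindex inj[OF S])
    then have "a (f x) mod int p = 0" if "x \<in> S" for x
      by (intro vanish[OF S that, of "\<lambda>x. a (f x)"]) auto
    moreover have "a (f x) mod int p = a (f x)" if "x \<in> S" for x
      using a(1) that by (auto simp: carrier_Fp Pi_iff)
    ultimately show "\<forall>v\<in>f ` S. a v = \<zero>\<^bsub>Fp p\<^esub>"
      by (auto simp: zero_Fp)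
  qed
  have "f ` S \<in> universal_complex p r" if S: "S \<subseteq> I" "card S \<le> d" for S
    unfolding universal_complex_def using fc indep[OF S] V.vs_zero_lin_dep[of "f ` S"] by blast
  then have "simplicial_map f {S. S \<subseteq> I \<and> card S \<le> d} (universal_complex p r)"
    by (simp add: simplicial_map_def)
  then show ?thesis
    using inj by (auto simp: nondegenerate_def)
qed

section \<open>Averaging the weight of relations\<close>

text \<open>
This is the inequality \<open>|S| \<le> |im g| * |ker g|\<close> for an additive map \<open>g\<close>, in a form that needs no
group structure: subtracting a fixed element of a fibre of \<open>g\<close> embeds the fibre into \<open>K\<close>.
\<close>

lemma card_le_card_image_mult_card_differences:
  fixes n :: int
  assumes n: "0 < n" and S: "finite S" "S \<subseteq> I \<rightarrow>\<^sub>E {0..<n}" and K: "finite K"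
    and g: "\<And>c c'. c \<in> S \<Longrightarrow> c' \<in> S \<Longrightarrow> g c = g c' \<Longrightarrow> (\<lambda>i\<in>I. (c i - c' i) mod n) \<in> K"
  shows "card S \<le> card (g ` S) * card K"
proof -
  have fibre: "card {c \<in> S. g c = y} \<le> card K" if y: "y \<in> g ` S" for y
  proof -
    obtain c' where c': "c' \<in> S" "g c' = y" using y by auto
    have "inj_on (\<lambda>c. \<lambda>i\<in>I. (c i - c' i) mod n) {c \<in> S. g c = y}"
    proof (rule inj_onI)
      fix c e assume ce: "c \<in> {c \<in> S. g c = y}" "e \<in> {c \<in> S. g c = y}"
        and eq: "(\<lambda>i\<in>I. (c i - c' i) mod n) = (\<lambda>i\<in>I. (e i - c' i) mod n)"
      show "c = e"
      proof (rule PiE_ext)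
        show "c \<in> I \<rightarrow>\<^sub>E {0..<n}" "e \<in> I \<rightarrow>\<^sub>E {0..<n}" using ce S by auto
        fix i assume i: "i \<in> I"
        then have "(c i - c' i) mod n = (e i - c' i) mod n"
          using fun_cong[OF eq, of i] by simp
        then have "c i mod n = e i mod n"
          by (metis diff_add_cancel mod_add_left_eq)
        moreover have "c i \<in> {0..<n}" "e i \<in> {0..<n}"
          using ce S(2) i by (blast dest: PiE_mem)+
        ultimately show "c i = e i" by simp
      qed
    qed
    then show ?thesis
      by (rule card_inj_on_le) (use g c' K in auto)
  qed
  have "card S = card (\<Union>y\<in>g ` S. {c \<in> S. g c = y})"
    by (rule arg_cong[where f = card]) auto
  also have "\<dots> \<le> (\<Sum>y\<in>g ` S. card {c \<in> S. g c = y})"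
    using S by (intro card_UN_le) auto
  also have "\<dots> \<le> card (g ` S) * card K"
    using sum_bounded_above[OF fibre] by simp
  finally show ?thesis .
qed

lemma nonzero_entry_of_relation:
  assumes "c \<in> relations p r I H" "c \<noteq> (\<lambda>i\<in>I. 0)"
  shows "\<exists>i\<in>I. c i \<noteq> 0"
proof (rule ccontr)
  assume "\<not> (\<exists>i\<in>I. c i \<noteq> 0)"
  moreover have "c \<in> extensional I" using assms(1) by (simp add: relations_def PiE_def)
  ultimately have "c = (\<lambda>i\<in>I. 0)" by (intro extensionalityI[of c I]) auto
  with assms(2) show False ..
qed

lemma finite_relations: "finite I \<Longrightarrow> finite (relations p r I H)"
  by (rule finite_subset[of _ "I \<rightarrow>\<^sub>E {0..<int p}"]) (auto simp: relations_def intro: finite_PiE)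

lemma dvd_sum_diff_of_cong:
  assumes "finite I" "[(\<Sum>i\<in>I. c i * H i j) = (\<Sum>i\<in>I. c' i * H i j)] (mod n :: int)"
  shows "n dvd (\<Sum>i\<in>I. (\<lambda>i\<in>I. (c i - c' i) mod n) i * H i j)"
proof -
  have "[(\<Sum>i\<in>I. (\<lambda>i\<in>I. (c i - c' i) mod n) i * H i j) = (\<Sum>i\<in>I. (c i - c' i) * H i j)] (mod n)"
    by (intro cong_sum) (simp add: cong_def mod_simps)
  moreover have "n dvd (\<Sum>i\<in>I. (c i - c' i) * H i j)"
    using assms(2) by (simp add: left_diff_distrib sum_subtractf cong_iff_dvd_diff)
  ultimately show ?thesis by (simp add: cong_dvd_iff)
qed

text \<open>
The relations are the kernel of the map sending a tuple to its \<open>r\<close> parity checks, which takes at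
most \<open>p ^ r\<close> values. So the code has dimension at least \<open>card I - r\<close>, stated by counting.
\<close>

lemma power_card_le_card_relations:
  assumes p: "0 < p" and I: "finite I"
  shows "p ^ card I \<le> p ^ r * card (relations p r I H)"
proof -
  let ?S = "I \<rightarrow>\<^sub>E {0..<int p}"
  define g where "g c = (\<lambda>j\<in>{..<r}. (\<Sum>i\<in>I. c i * H i j) mod int p)" for c
  have "card ?S \<le> card (g ` ?S) * card (relations p r I H)"
  proof (rule card_le_card_image_mult_card_differences[where n = "int p" and I = I])
    fix c c' assume eq: "g c = g c'"
    have "[(\<Sum>i\<in>I. c i * H i j) = (\<Sum>i\<in>I. c' i * H i j)] (mod int p)" if "j < r" for j
      using that fun_cong[OF eq, of j] by (simp add: g_def cong_def)
    then show "(\<lambda>i\<in>I. (c i - c' i) mod int p) \<in> relations p r I H"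
      using p I dvd_sum_diff_of_cong[of I c H _ c' "int p"] unfolding relations_def by auto
  qed (use p I in \<open>auto intro: finite_PiE finite_relations\<close>)
  moreover have "card (g ` ?S) \<le> card ({..<r} \<rightarrow>\<^sub>E {0..<int p})"
    using p by (intro card_mono finite_PiE image_subsetI) (simp_all add: g_def restrict_PiE_iff)
  moreover have "card ({..<r} \<rightarrow>\<^sub>E {0..<int p}) = p ^ r" "card ?S = p ^ card I"
    using I by (simp_all add: card_PiE)
  ultimately show ?thesis
    by (metis mult_le_mono1 order_trans)
qed

text \<open>
Evaluation at \<open>i\<close> takes at most \<open>p\<close> values, so at least one relation in \<open>p\<close> vanishes at \<open>i\<close>.
\<close>

lemma card_relations_le_card_vanishing:
  assumes p: "0 < p" and I: "finite I" "i \<in> I"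
  shows "card (relations p r I H) \<le> p * card {c \<in> relations p r I H. c i = 0}"
proof -
  let ?C = "relations p r I H"
  have "card ?C \<le> card ((\<lambda>c. c i) ` ?C) * card {c \<in> ?C. c i = 0}"
  proof (rule card_le_card_image_mult_card_differences[where n = "int p" and I = I])
    fix c c' assume "c \<in> ?C" "c' \<in> ?C" "c i = c' i"
    then show "(\<lambda>i\<in>I. (c i - c' i) mod int p) \<in> {c \<in> ?C. c i = 0}"
      using p I dvd_sum_diff_of_cong[of I c H _ c' "int p"]
      by (auto simp: relations_def cong_iff_dvd_diff)
  qed (use p I in \<open>auto simp: finite_relations\<close>, auto simp: relations_def)
  moreover have "card ((\<lambda>c. c i) ` ?C) \<le> card {0..<int p}"
    using I by (intro card_mono) (auto simp: relations_def)
  ultimately show ?thesis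
    by (auto intro: order_trans[OF _ mult_le_mono1])
qed

text \<open>
Plotkin's averaging argument. Each coordinate is nonzero on at most a fraction \<open>1 - 1 / p\<close> of the
\<open>M\<close> relations, hence the average weight of the nonzero ones is at most
\<open>card I * (1 - 1 / p) * M / (M - 1)\<close>. For \<open>M \<ge> p\<^sup>2\<close> this is at most \<open>card I * p / (p + 1)\<close>,
and the minimum weight cannot exceed the average.
\<close>

lemma plotkin_bound:
  assumes p: "1 < p" and I: "finite I" and C: "p\<^sup>2 \<le> card (relations p r I H)"
    and d: "\<And>c i. c \<in> relations p r I H \<Longrightarrow> i \<in> I \<Longrightarrow> c i \<noteq> 0 \<Longrightarrow> d \<le> weight I c"
  shows "d * (p + 1) \<le> p * card I"
proof -
  let ?C = "relations p r I H"
  define M where "M = int (card ?C)"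
  define z :: "'a \<Rightarrow> int" where "z = (\<lambda>i\<in>I. 0)"
  have fin: "finite ?C" using I by (rule finite_relations)
  have "d \<le> weight I c" if "c \<in> ?C - {z}" for c
  proof -
    have "\<exists>i\<in>I. c i \<noteq> 0"
      using that nonzero_entry_of_relation[of c p r I H] by (simp add: z_def)
    then show ?thesis using d that by auto
  qed
  then have "card (?C - {z}) * d \<le> (\<Sum>c\<in>?C - {z}. weight I c)"
    using sum_bounded_below[of "?C - {z}" d "weight I"] by simp
  also have "\<dots> \<le> (\<Sum>c\<in>?C. weight I c)"
    using fin by (intro sum_mono2) auto
  also have "\<dots> = (\<Sum>c\<in>?C. \<Sum>i\<in>I. if c i \<noteq> 0 then 1 else 0)"
    unfolding weight_def card_eq_sum by (intro sum.cong sum.inter_filter I refl)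
  also have "\<dots> = (\<Sum>i\<in>I. \<Sum>c\<in>?C. if c i \<noteq> 0 then 1 else 0)"
    by (rule sum.swap)
  also have "\<dots> = (\<Sum>i\<in>I. card {c \<in> ?C. c i \<noteq> 0})"
    unfolding card_eq_sum by (intro sum.cong sum.inter_filter[symmetric] fin refl)
  finally have "int (card (?C - {z})) * d \<le> (\<Sum>i\<in>I. int (card {c \<in> ?C. c i \<noteq> 0}))"
    unfolding of_nat_mult[symmetric] of_nat_sum[symmetric] of_nat_le_iff .
  moreover have "M - 1 \<le> int (card (?C - {z}))"
    using card_Diff_singleton_if[of ?C z] fin unfolding M_def by (auto split: if_splits)
  ultimately have "(M - 1) * d \<le> (\<Sum>i\<in>I. int (card {c \<in> ?C. c i \<noteq> 0}))"
    by (meson mult_right_mono of_nat_0_le_iff order_trans)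
  moreover have "int p * int (card {c \<in> ?C. c i \<noteq> 0}) \<le> (int p - 1) * M" if "i \<in> I" for i
  proof -
    have "card ?C = card {c \<in> ?C. c i = 0} + card {c \<in> ?C. c i \<noteq> 0}"
      using fin by (subst card_Un_disjoint[symmetric]) (auto intro: arg_cong[where f = card])
    then have "M = int (card {c \<in> ?C. c i = 0}) + int (card {c \<in> ?C. c i \<noteq> 0})"
      unfolding M_def by linarith
    moreover have "M \<le> int p * int (card {c \<in> ?C. c i = 0})"
      using card_relations_le_card_vanishing[of p I i r H] p I that
      unfolding M_def of_nat_mult[symmetric] of_nat_le_iff by simp
    ultimately show ?thesis by (simp add: algebra_simps)
  qed
  then have "int p * (\<Sum>i\<in>I. int (card {c \<in> ?C. c i \<noteq> 0})) \<le> (\<Sum>i\<in>I. (int p - 1) * M)"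
    unfolding sum_distrib_left by (rule sum_mono)
  ultimately have avg: "int p * ((M - 1) * d) \<le> int (card I) * ((int p - 1) * M)"
    using mult_left_mono[of "(M - 1) * d" _ "int p"] by fastforce
  have M: "(int p)\<^sup>2 \<le> M"
    using C unfolding M_def by (metis of_nat_le_iff of_nat_power)
  have "int p * (M - 1) * (d * (int p + 1)) = (int p * ((M - 1) * d)) * (int p + 1)"
    by (simp add: algebra_simps)
  also have "\<dots> \<le> (int (card I) * ((int p - 1) * M)) * (int p + 1)"
    using avg by (intro mult_right_mono) auto
  also have "\<dots> = int (card I) * (M * (int p)\<^sup>2 - M)"
    by (simp add: algebra_simps power2_eq_square)
  also have "\<dots> \<le> int (card I) * (M * (int p)\<^sup>2 - (int p)\<^sup>2)"
    using M by (intro mult_left_mono) auto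
  also have "\<dots> = int p * (M - 1) * (int p * int (card I))"
    by (simp add: algebra_simps power2_eq_square)
  finally have "d * (int p + 1) \<le> int p * int (card I)"
  proof (rule mult_left_le_imp_le)
    have "1 < (int p)\<^sup>2" using p by simp
    then have "0 < M - 1" using M by linarith
    then show "0 < int p * (M - 1)" using p by simp
  qed
  then show ?thesis
    by (metis of_nat_1 of_nat_add of_nat_le_iff of_nat_mult)
qed

section \<open>Codes of dimension zero, one and two\<close>

lemma weight_all_nonzero: "finite I \<Longrightarrow> (\<And>i. i \<in> I \<Longrightarrow> c i \<noteq> 0) \<Longrightarrow> weight I c = card I"
  unfolding weight_def by (rule arg_cong[where f = card]) auto

lemma dvd_sum_relations:
  "c \<in> relations p r I H \<Longrightarrow> j < r \<Longrightarrow> int p dvd (\<Sum>i\<in>I. c i * H i j)"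
  by (simp add: relations_def)

lemma card_residue_class_le:
  fixes n s m :: nat
  assumes "0 < n"
  shows "card {u \<in> {0..m}. u mod n = s} \<le> m div n + 1"
proof -
  have "inj_on (\<lambda>u. u div n) {u \<in> {0..m}. u mod n = s}"
    by (rule inj_onI) (metis (mono_tags, lifting) div_mult_mod_eq mem_Collect_eq)
  then have "card {u \<in> {0..m}. u mod n = s} \<le> card {0..m div n}"
    by (rule card_inj_on_le) (auto simp: div_le_mono)
  then show ?thesis by simp
qed

lemma identity_relations_trivial:
  assumes c: "c \<in> relations p N {1..N} (\<lambda>i j. of_bool (i = j + 1))" and i: "i \<in> {1..N}"
  shows "c i = 0"
proof -
  have "int p dvd (\<Sum>x\<in>{1..N}. c x * of_bool (x = i - 1 + 1))"
    using i by (intro dvd_sum_relations[OF c]) auto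
  also have "(\<Sum>x\<in>{1..N}. c x * of_bool (x = i - 1 + 1)) = c i"
    using i by (simp add: of_bool_def if_distrib cong: if_cong)
  finally have "int p dvd c i" .
  moreover have "c i \<in> {0..<int p}" using c i by (auto simp: relations_def)
  ultimately show ?thesis by (auto simp: dvd_eq_mod_eq_0)
qed

text \<open>
For the unit vectors and minus their sum, every relation is constant: this is the repetition code,
and all its nonzero words have full weight.
\<close>

lemma repetition_code_weight:
  assumes c: "c \<in> relations p m {1..m + 1} (\<lambda>i j. of_bool (i = j + 1) - of_bool (i = m + 1))"
    and i: "i \<in> {1..m + 1}" "c i \<noteq> 0"
  shows "weight {1..m + 1} c = m + 1"
proof -
  have eq: "c x = c (m + 1)" if x: "x \<in> {1..m + 1}" for x
  proof (cases "x = m + 1")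
    case False
    then have "int p dvd (\<Sum>y\<in>{1..m + 1}. c y * (of_bool (y = x - 1 + 1) - of_bool (y = m + 1)))"
      using x by (intro dvd_sum_relations[OF c]) auto
    also have "(\<Sum>y\<in>{1..m + 1}. c y * (of_bool (y = x - 1 + 1) - of_bool (y = m + 1))) =
        c x - c (m + 1)"
      using x by (simp add: of_bool_def right_diff_distrib sum_subtractf if_distrib[of "\<lambda>t. _ * t"]
          del: sum.cl_ivl_Suc cong: if_cong)
    finally have "[c x = c (m + 1)] (mod int p)" by (simp add: cong_iff_dvd_diff)
    moreover have "c x \<in> {0..<int p}" "c (m + 1) \<in> {0..<int p}"
      using c x by (auto simp: relations_def)
    ultimately show ?thesis by (simp add: cong_def)
  qed simp
  have "weight {1..m + 1} c = card {1..m + 1}"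
    by (rule weight_all_nonzero) (use eq i(2) eq[OF i(1)] in \<open>simp_all del: atLeastAtMost_iff\<close>)
  then show ?thesis by simp
qed

text \<open>
Representatives of the \<open>p + 1\<close> points of the projective line over \<open>\<F>\<^sub>p\<close>, repeated cyclically in \<open>u\<close>.
The residues \<open>0\<close> and \<open>1\<close> give \<open>(0, 1)\<close> and \<open>(1, 0)\<close>, so that the code built from them below
is systematic in its last two positions; the truncated subtraction \<open>0 - 1 = 0\<close> is what sends the
residue \<open>0\<close> to \<open>(0, 1)\<close>, and the residues \<open>2, ..., p\<close> give the slopes \<open>1, ..., p - 1\<close>.
\<close>

definition line_coords :: "nat \<Rightarrow> nat \<Rightarrow> int \<times> int" where
  "line_coords p u =
     (let s = u mod (p + 1) in if s = 1 then (1, 0) else (int (s - 1), 1))"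

text \<open>
Distinct points of the projective line are linearly independent, so a linear form vanishing at two
of them is zero. At most one of the two is the point \<open>(1, 0)\<close>, and by symmetry the other is taken
to be the second one.
\<close>

lemma line_coords_independent:
  assumes p: "prime p" and uv: "u mod (p + 1) \<noteq> v mod (p + 1)"
    and u: "int p dvd a * fst (line_coords p u) + b * snd (line_coords p u)"
    and v: "int p dvd a * fst (line_coords p v) + b * snd (line_coords p v)"
  shows "int p dvd a \<and> int p dvd b"
proof -
  have *: "int p dvd a \<and> int p dvd b"
    if s: "s < p + 1" and t: "t < p + 1" "t \<noteq> 1" "s \<noteq> t"
      and ds: "int p dvd (if s = 1 then a else a * int (s - 1) + b)"
      and dt: "int p dvd a * int (t - 1) + b" for s t
  proof -
    have a: "int p dvd a"
    proof (cases "s = 1")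
      case False
      have "int p dvd a * int (s - 1) + b" using ds False by simp
      then have "int p dvd (a * int (s - 1) + b) - (a * int (t - 1) + b)"
        using dt by (rule dvd_diff)
      then have "int p dvd a * (int (s - 1) - int (t - 1))" by (simp add: algebra_simps)
      moreover have "\<not> int p dvd int (s - 1) - int (t - 1)"
      proof
        assume "int p dvd int (s - 1) - int (t - 1)"
        then have "(s - 1) mod p = (t - 1) mod p"
          by (metis mod_eq_dvd_iff of_nat_eq_iff zmod_int)
        moreover have "s - 1 < p" "t - 1 < p" using s t p prime_gt_0_nat[OF p] by linarith+
        ultimately show False using False t by (cases s; cases t) auto
      qed
      ultimately show ?thesis using p by (simp add: prime_dvd_mult_iff)
    qed (use ds in simp)
    then have "int p dvd b" using dt by (simp add: dvd_add_right_iff)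
    with a show ?thesis ..
  qed
  let ?s = "u mod (p + 1)" and ?t = "v mod (p + 1)"
  have lt: "?s < p + 1" "?t < p + 1" by simp_all
  show ?thesis
  proof (cases "?t = 1")
    case False
    then show ?thesis
      by (intro *[of ?s ?t]) (use lt uv u v in \<open>auto simp: line_coords_def Let_def split: if_splits\<close>)
  next
    case True
    then show ?thesis
      by (intro *[of ?t ?s]) (use lt uv u v in \<open>auto simp: line_coords_def Let_def split: if_splits\<close>)
  qed
qed

text \<open>
The relations here are the evaluations of the linear forms \<open>a x + b y\<close> at the points
\<open>line_coords p (m + 1 - i)\<close>, with \<open>a\<close> and \<open>b\<close> stored in positions \<open>m\<close> and \<open>m + 1\<close>. A nonzero form
vanishes at one point of the projective line at most, and since the \<open>m + 1\<close> positions are spread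
evenly over the \<open>p + 1\<close> points, this point occurs at most \<open>m div (p + 1) + 1\<close> times. The
minimum weight thus equals the integer part of the bound in \<open>plotkin_bound\<close>.
\<close>

lemma two_dim_code_weight:
  fixes m p :: nat
  defines "A \<equiv> \<lambda>i. fst (line_coords p (m + 1 - i))" and "B \<equiv> \<lambda>i. snd (line_coords p (m + 1 - i))"
  assumes p: "prime p" and m: "1 \<le> m"
    and c: "c \<in> relations p (m - 1) {1..m + 1}
      (\<lambda>i j. of_bool (i = j + 1) - A (j + 1) * of_bool (i = m) - B (j + 1) * of_bool (i = m + 1))"
    and i: "i \<in> {1..m + 1}" "c i \<noteq> 0"
  shows "m - m div (p + 1) \<le> weight {1..m + 1} c"
proof -
  have p2: "2 \<le> p" using p by (rule prime_ge_2_nat)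
  define a b where "a = c m" and "b = c (m + 1)"
  have range: "c x \<in> {0..<int p}" if "x \<in> {1..m + 1}" for x
    using c that by (auto simp: relations_def)
  have eq: "[c x = a * A x + b * B x] (mod int p)" if x: "x \<in> {1..m + 1}" for x
  proof -
    consider "x = m" | "x = m + 1" | "x \<in> {1..m - 1}" using x by force
    then show ?thesis
    proof cases
      assume "x = m"
      then show ?thesis using p2 by (simp add: A_def B_def line_coords_def a_def)
    next
      assume "x = m + 1"
      then show ?thesis using p2 by (simp add: A_def B_def line_coords_def b_def)
    next
      assume x': "x \<in> {1..m - 1}"
      then have "x - 1 < m - 1" "x - 1 + 1 = x" by auto
      then have "int p dvd (\<Sum>y\<in>{1..m + 1}. c y *
          (of_bool (y = x) - A x * of_bool (y = m) - B x * of_bool (y = m + 1)))"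
        using dvd_sum_relations[OF c, of "x - 1"] by (simp only:)
      also have "(\<Sum>y\<in>{1..m + 1}. c y *
          (of_bool (y = x) - A x * of_bool (y = m) - B x * of_bool (y = m + 1))) =
          c x - a * A x - b * B x"
        using x m by (simp add: a_def b_def of_bool_def right_diff_distrib sum_subtractf
            if_distrib[of "\<lambda>t. _ * t"] mult.assoc del: sum.cl_ivl_Suc cong: if_cong)
      finally show ?thesis by (simp add: cong_iff_dvd_diff algebra_simps)
    qed
  qed
  let ?Z = "{x \<in> {1..m + 1}. c x = 0}"
  have same: "(m + 1 - x) mod (p + 1) = (m + 1 - y) mod (p + 1)" if xy: "x \<in> ?Z" "y \<in> ?Z" for x y
  proof (rule ccontr)
    assume ne: "(m + 1 - x) mod (p + 1) \<noteq> (m + 1 - y) mod (p + 1)"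
    have d: "int p dvd a * A x + b * B x" "int p dvd a * A y + b * B y"
      using eq[of x] eq[of y] xy by (simp_all add: cong_def dvd_eq_mod_eq_0)
    have "int p dvd a \<and> int p dvd b"
      by (rule line_coords_independent[OF p ne]) (use d in \<open>simp_all add: A_def B_def\<close>)
    then have "int p dvd a * A i + b * B i" by simp
    then have "int p dvd c i" using eq[OF i(1)] by (simp add: cong_dvd_iff)
    then show False using range[OF i(1)] i(2) by (auto dest: zdvd_imp_le)
  qed
  have Z: "card ?Z \<le> m div (p + 1) + 1"
  proof (cases "?Z = {}")
    case False
    then obtain y where y: "y \<in> ?Z" by auto
    have "card ?Z \<le> card {u \<in> {0..m}. u mod (p + 1) = (m + 1 - y) mod (p + 1)}"
    proof (rule card_inj_on_le)
      show "inj_on (\<lambda>x. m + 1 - x) ?Z"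
        by (rule inj_on_subset[of _ "{..m + 1}"]) (auto simp: inj_on_def)
      show "(\<lambda>x. m + 1 - x) ` ?Z \<subseteq> {u \<in> {0..m}. u mod (p + 1) = (m + 1 - y) mod (p + 1)}"
      proof (rule image_subsetI)
        fix x assume "x \<in> ?Z"
        then show "m + 1 - x \<in> {u \<in> {0..m}. u mod (p + 1) = (m + 1 - y) mod (p + 1)}"
          using same[OF _ y] by (simp only: mem_Collect_eq atLeastAtMost_iff) linarith
      qed
    qed simp
    also have "\<dots> \<le> m div (p + 1) + 1"
      by (rule card_residue_class_le) simp
    finally show ?thesis .
  qed (simp only: card.empty)
  have "card {1..m + 1} = card ?Z + weight {1..m + 1} c"
  proof -
    have "{1..m + 1} = ?Z \<union> {x \<in> {1..m + 1}. c x \<noteq> 0}" by blast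
    moreover have "card (?Z \<union> {x \<in> {1..m + 1}. c x \<noteq> 0}) = card ?Z + weight {1..m + 1} c"
      unfolding weight_def by (rule card_Un_disjoint) auto
    ultimately show ?thesis by metis
  qed
  then show ?thesis using Z by simp
qed

section \<open>Skeleta with Buchstaber invariant one\<close>

text \<open>
The invariant is \<open>1\<close> exactly when \<open>m\<close> is the least dimension of a target. Dimension \<open>m\<close> suffices iff
\<open>k < m\<close>, because some nonzero relation between \<open>m + 1\<close> vectors exists and in general position it has
full weight. A smaller dimension gives at least \<open>p\<^sup>2\<close> relations; then the averaging bound and the
two-dimensional code show that some smaller dimension suffices iff \<open>k + 1 + m div (p + 1) < m\<close>.
\<close>

lemma buchstaber_skeleton_simplex_eq_1_iff:
  assumes p: "prime p" and m: "1 \<le> m" and k: "k \<le> m"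
  shows "buchstaber p (skeleton k (simplex m)) = 1 \<longleftrightarrow>
    k < m \<and> m \<le> k + 1 + m div (p + 1)"
proof -
  define I where "I = {1..m + 1}"
  define K where "K = {S. S \<subseteq> I \<and> card S \<le> k + 1}"
  define Q where "Q r \<longleftrightarrow>
    (\<exists>f. simplicial_map f K (universal_complex p r) \<and> nondegenerate f K)" for r
  have I: "finite I" "card I = m + 1" by (auto simp: I_def)
  have p1: "1 < p" using p by (rule prime_gt_1_nat)
  have K: "skeleton k (simplex m) = K"
    by (auto simp: skeleton_def simplex_def K_def I_def)
  have val: "buchstaber p (skeleton k (simplex m)) = int (m + 1) - int (LEAST r. Q r)"
    using vertices_skeleton_simplex[of k m] by (simp add: buchstaber_def K Q_def)
  have QI: "Q r" if "\<And>c i. c \<in> relations p r I H \<Longrightarrow> i \<in> I \<Longrightarrow> c i \<noteq> 0 \<Longrightarrow> k + 1 < weight I c" for r H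
    unfolding Q_def K_def using nondegenerate_map_if_weight_relation_gt[OF p I(1) that] .
  have QD: "\<exists>H. \<forall>c\<in>relations p r I H. \<forall>i\<in>I. c i \<noteq> 0 \<longrightarrow> k + 2 \<le> weight I c" if "Q r" for r
    using that weight_relation_gt_if_nondegenerate_map[OF p I(1), of _ "k + 1" r]
    unfolding Q_def K_def by fastforce
  \<comment> \<open>Needed so that the least admissible dimension is attained, also when \<open>k = m\<close>.\<close>
  have Q_top: "Q (m + 1)"
    using identity_relations_trivial[of _ p "m + 1"]
    by (intro QI[of "m + 1" "\<lambda>i j. of_bool (i = j + 1)"]) (auto simp: I_def)
  have Q_m: "Q m" if "k < m"
    using repetition_code_weight[of _ p m] that unfolding I_def[symmetric]
    by (intro QI[of m "\<lambda>i j. of_bool (i = j + 1) - of_bool (i = m + 1)"]) auto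
  have Q_pred: "Q (m - 1)" if "k + 1 + m div (p + 1) < m"
    using two_dim_code_weight[OF p m] that unfolding I_def[symmetric]
    by (intro QI) fastforce
  have k_less: "k < m" if Qm: "Q m"
  proof -
    obtain H where H: "\<And>c i. c \<in> relations p m I H \<Longrightarrow> i \<in> I \<Longrightarrow> c i \<noteq> 0 \<Longrightarrow> k + 2 \<le> weight I c"
      using QD[OF Qm] by blast
    have "p ^ m * p \<le> p ^ m * card (relations p m I H)"
      using power_card_le_card_relations[of p I m H] p1 I by simp
    then have C: "1 < card (relations p m I H)" using p1 by simp
    have "\<not> relations p m I H \<subseteq> {\<lambda>i\<in>I. 0}"
    proof
      assume "relations p m I H \<subseteq> {\<lambda>i\<in>I. 0}"
      from card_mono[OF _ this] C show False by simp
    qed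
    then obtain c where "c \<in> relations p m I H" "c \<noteq> (\<lambda>i\<in>I. 0)" by blast
    then have "k + 2 \<le> weight I c" using H nonzero_entry_of_relation by blast
    also have "\<dots> \<le> card I" unfolding weight_def using I by (intro card_mono) auto
    finally show ?thesis using I by simp
  qed
  have small: "k + 1 + m div (p + 1) < m" if Qr: "Q r" "r < m" for r
  proof -
    obtain H where H: "\<And>c i. c \<in> relations p r I H \<Longrightarrow> i \<in> I \<Longrightarrow> c i \<noteq> 0 \<Longrightarrow> k + 2 \<le> weight I c"
      using QD[OF Qr(1)] by blast
    have "p ^ r * p\<^sup>2 \<le> p ^ (m + 1)"
      using p1 Qr(2) by (simp add: power_add[symmetric] del: power_Suc)
    also have "\<dots> \<le> p ^ r * card (relations p r I H)"
      using power_card_le_card_relations[of p I r H] p1 I by simp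
    finally have "p\<^sup>2 \<le> card (relations p r I H)" using p1 by simp
    then have "(k + 2) * (p + 1) \<le> p * (m + 1)"
      using plotkin_bound[OF p1 I(1) _ H] I by simp
    also have "\<dots> < (m - m div (p + 1) + 1) * (p + 1)"
    proof -
      define q s where "q = m div (p + 1)" and "s = m mod (p + 1)"
      have "m = q * (p + 1) + s" "s < p + 1"
        by (simp_all only: q_def s_def div_mult_mod_eq) simp
      then have "m - q + 1 = q * p + s + 1" by simp
      moreover have "p * (m + 1) < (q * p + s + 1) * (p + 1)"
        using \<open>m = q * (p + 1) + s\<close> \<open>s < p + 1\<close> by (simp add: algebra_simps)
      ultimately show ?thesis by (simp only: q_def)
    qed
    finally have "k + 2 < m - m div (p + 1) + 1"
      unfolding mult_less_cancel2 by (rule conjunct2)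
    then show ?thesis by linarith
  qed
  have "(LEAST r. Q r) = m \<longleftrightarrow> Q m \<and> (\<forall>r<m. \<not> Q r)"
  proof
    assume eq: "(LEAST r. Q r) = m"
    show "Q m \<and> (\<forall>r<m. \<not> Q r)"
      using LeastI[of Q, OF Q_top] not_less_Least[of _ Q] unfolding eq by blast
  next
    assume "Q m \<and> (\<forall>r<m. \<not> Q r)"
    then show "(LEAST r. Q r) = m"
      by (intro Least_equality) (auto intro: leI)
  qed
  also have "\<dots> \<longleftrightarrow> k < m \<and> \<not> k + 1 + m div (p + 1) < m"
  proof -
    have "m - 1 < m" using m by simp
    then show ?thesis using Q_m Q_pred k_less small by blast
  qed
  finally show ?thesis
    using val by auto
qed

text \<open>
If \<open>k + 1\<close> is a multiple of \<open>p\<close>, the lower bound on \<open>k + 1\<close> can be rounded up to a multiple of \<open>p\<close>.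
For \<open>m = q * (p + 1) + s\<close> with \<open>s \<le> p\<close> it reads \<open>q * p + s \<le> k + 1\<close>, and \<open>q * p + s\<close> rounds up to
\<open>q * p\<close> if \<open>s = 0\<close> and to \<open>(q + 1) * p\<close> otherwise, which is \<open>p * ((m - 1) div (p + 1)) + p\<close> in both cases.
\<close>

lemma last_residue_class_threshold:
  fixes p m k :: nat
  assumes m: "1 \<le> m" and p: "1 < p" and k: "k mod p = p - 1"
  shows "m \<le> k + 1 + m div (p + 1) \<longleftrightarrow> p * ((m - 1) div (p + 1)) + p \<le> k + 1"
proof -
  define t q s where "t = k div p" and "q = m div (p + 1)" and "s = m mod (p + 1)"
  have kt: "k + 1 = p * (t + 1)"
    using div_mult_mod_eq[of k p] k p by (simp add: t_def algebra_simps)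
  have "s < p + 1" by (simp add: s_def)
  then have ms: "m = q * (p + 1) + s" "s \<le> p"
    by (simp_all only: q_def s_def div_mult_mod_eq)
  have "m \<le> k + 1 + q \<longleftrightarrow> q * p + s \<le> p * (t + 1)"
    using kt ms(1) by (simp only: distrib_left mult_1_right) linarith
  also have "\<dots> \<longleftrightarrow> (if s = 0 then q \<le> t + 1 else q \<le> t)"
  proof (cases "s = 0")
    case True
    then have "q * p + s \<le> p * (t + 1) \<longleftrightarrow> p * q \<le> p * (t + 1)"
      by (simp only: add_0_right mult.commute[of q p])
    also have "\<dots> \<longleftrightarrow> q \<le> t + 1"
      unfolding mult_le_cancel1 using p by linarith
    finally show ?thesis using True by simp
  next
    case False
    have "q * p + s \<le> p * (t + 1)" if "q \<le> t"
      using add_mono[OF mult_le_mono2[OF that, of p] ms(2)]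
      by (simp only: distrib_left mult_1_right mult.commute[of q p])
    moreover have "q \<le> t" if "q * p + s \<le> p * (t + 1)"
    proof -
      have "p * q < p * (t + 1)" using that False by (simp add: mult.commute)
      then have "q < t + 1" unfolding mult_less_cancel1 by (rule conjunct2)
      then show ?thesis by simp
    qed
    ultimately show ?thesis using False by auto
  qed
  also have "\<dots> \<longleftrightarrow> (m - 1) div (p + 1) \<le> t"
  proof (cases "s = 0")
    case True
    then obtain q' where q': "q = Suc q'" using m ms(1) by (cases q) auto
    have "m - 1 = p + q' * (p + 1)" using ms(1) True q' by simp
    then have "(m - 1) div (p + 1) = q'" by (simp del: mult_Suc_right)
    then show ?thesis using True q' by simp
  next
    case False
    then have "(m - 1) div (p + 1) = q"
      using ms by (intro div_nat_eqI) (auto simp: algebra_simps)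
    then show ?thesis using False by simp
  qed
  also have "\<dots> \<longleftrightarrow> p * ((m - 1) div (p + 1)) + p \<le> k + 1"
  proof -
    define d where "d = (m - 1) div (p + 1)"
    have "p * d + p = p * (d + 1)" by simp
    then have "p * d + p \<le> k + 1 \<longleftrightarrow> d \<le> t"
      unfolding kt using p by (simp only: mult_le_cancel1) linarith
    then show ?thesis by (simp add: d_def)
  qed
  finally show ?thesis by (simp add: q_def)
qed

theorem corollary3p8:
  fixes m k p :: nat
  assumes "m \<ge> 2" and "k \<le> m" and "prime p"
  shows "buchstaber p (skeleton k (simplex m)) = 1 \<longleftrightarrow>
    (\<not> [k = p - 1] (mod p) \<and>
       int m - \<lfloor>real m / real (p + 1)\<rfloor> - 1 \<le> int k \<and> int k \<le> int m - 1) \<or>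
    ([k = p - 1] (mod p) \<and>
       int p * \<lfloor>real (m - 1) / real (p + 1)\<rfloor> + int p - 1 \<le> int k \<and> int k \<le> int m - 1)"
proof -
  have p1: "1 < p" using assms(3) by (rule prime_gt_1_nat)
  have fl: "\<lfloor>real a / real (p + 1)\<rfloor> = int (a div (p + 1))" for a
    by (rule floor_divide_of_nat_eq)
  have main: "buchstaber p (skeleton k (simplex m)) = 1 \<longleftrightarrow>
      k < m \<and> m \<le> k + 1 + m div (p + 1)"
    using buchstaber_skeleton_simplex_eq_1_iff[OF assms(3) _ assms(2)] assms(1) by simp
  have lt: "int k \<le> int m - 1 \<longleftrightarrow> k < m" by linarith
  have i: "int m - int (m div (p + 1)) - 1 \<le> int k \<longleftrightarrow> m \<le> k + 1 + m div (p + 1)"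
    by linarith
  have ii: "int p * int ((m - 1) div (p + 1)) + int p - 1 \<le> int k \<longleftrightarrow>
      p * ((m - 1) div (p + 1)) + p \<le> k + 1"
    unfolding of_nat_mult[symmetric] by linarith
  have "m \<le> k + 1 + m div (p + 1) \<longleftrightarrow> p * ((m - 1) div (p + 1)) + p \<le> k + 1"
    if "[k = p - 1] (mod p)"
    using last_residue_class_threshold[of m p k] that assms(1) p1 by (simp add: cong_def)
  then show ?thesis
    unfolding main fl lt i ii by blast
qed

end
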